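(* Let $X$ be a real Hilbert space, let $c_1, c_2 \in X \smallsetminus \{0\}$, let $\gamma_1, \gamma_2 \in \mathbb{R}$, and set $$H_1 := \{x \in X : \langle x, c_1\rangle = \gamma_1\} \quad\text{and}\quad H_2 := \{x \in X : \langle x, c_2\rangle = \gamma_2\}.$$ Let $x \in X$. Then the following hold: (i) If $\langle c_1, c_2\rangle^2 = \|c_1\|^2\|c_2\|^2$ and $\|c_1\|^2(\langle x, c_2\rangle - \gamma_2) = \langle c_1, c_2\rangle(\langle x, c_1\rangle - \gamma_1)$, then $H_1 = H_2$ and $$P_{H_1 \cap H_2}(x) = P_{H_1}(x) = x - \frac{\langle x, c_1\rangle - \gamma_1}{\|c_1\|^2}\, c_1.$$ (ii) If $\langle c_1, c_2\rangle^2 = \|c_1\|^2\|c_2\|^2$ and $\|c_1\|^2(\langle x, c_2\rangle - \gamma_2) \neq \langle c_1, c_2\rangle(\langle x, c_1\rangle - \gamma_1)$, then $H_1$ and $H_2$ are parallel but distinct ($H_1 \cap H_2 = \varnothing$), and $$P_{\operatorname{Fix}(P_{H_1}P_{H_2})}(x) = P_{H_1}(x) = x - \frac{\langle x, c_1\rangle - \gamma_1}{\|c_1\|^2}\, c_1.$$ (iii) If $\langle c_1, c_2\rangle^2 \neq \|c_1\|^2\|c_2\|^2$, then $H_1 \cap H_2 \neq \varnothing$ and $$P_{H_1 \cap H_2}(x) = x + \frac{\|c_2\|^2(\gamma_1 - \langle x, c_1\rangle) + \langle c_1, c_2\rangle(\langle x, c_2\rangle - \gamma_2)}{\|c_1\|^2\|c_2\|^2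 - \langle c_1, c_2\rangle^2}\, c_1 + \frac{\|c_1\|^2(\gamma_2 - \langle x, c_2\rangle) + \langle c_1, c_2\rangle(\langle x, c_1\rangle - \gamma_1)}{\|c_1\|^2\|c_2\|^2 - \langle c_1, c_2\rangle^2}\, c_2.$$
   Context: $\langle\cdot,\cdot\rangle$ is the inner product of $X$ and $\|\cdot\|$ the induced norm. For a nonempty closed convex set $C \subseteq X$, $P_C : X \to X$ denotes the nearest point mapping (orthogonal projection) onto $C$. $\operatorname{Fix}(P_{H_1} P_{H_2}) := \{x \in X : x = P_{H_1}(P_{H_2}(x))\}$. Two hyperplanes are parallel if they are translates of the same linear subspace. *)

theory Defs
  imports "HOL-Analysis.Analysis"
begin

(* The library's closest_point is restricted to the sort {real_inner, heine_borel}, which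
   excludes infinite-dimensional Hilbert spaces. The definite description is meaningful exactly
   when the nearest point exists and is unique, as is the case for nonempty closed convex C in a
   Hilbert space; otherwise the value is unspecified. *)
definition nearest_point :: "'a::{real_inner,complete_space} set \<Rightarrow> 'a \<Rightarrow> 'a"
  where "nearest_point C x = (THE p. p \<in> C \<and> (\<forall>y\<in>C. dist x p \<le> dist x y))"

definition Fix :: "('a \<Rightarrow> 'a) \<Rightarrow> 'a set"
  where "Fix T = {x. x = T x}"

definition parallel :: "'a::real_vector set \<Rightarrow> 'a set \<Rightarrow> bool"
  where "parallel H K \<longleftrightarrow> (\<exists>S a b. subspace S \<and> H = (\<lambda>v. a + v) ` S \<and> K = (\<lambda>v. b + v) ` S)"

end

theory Submission
  imports Defs
begin

text \<open>
  All projections here are computed from one criterion: a point \<open>p\<close> of \<open>C\<close> at which \<open>x - p\<close>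
  makes no acute angle with any direction \<open>y - p\<close> into \<open>C\<close> is the unique nearest point to \<open>x\<close>
  (\<open>nearest_point_eqI\<close>). So it suffices to exhibit the claimed points and check the angles.

  For a hyperplane, moving from \<open>x\<close> along its normal until the equation holds gives the usual
  formula. If equality holds in the Cauchy--Schwarz inequality, then \<open>c2 = t *\<^sub>R c1\<close> with
  \<open>t \<noteq> 0\<close>, so both hyperplanes are level sets of \<open>\<lambda>z. z \<bullet> c1\<close>, at the levels \<open>\<gamma>1\<close> and
  \<open>\<gamma>2 / t\<close>. The second hypothesis of (i) says exactly that these levels agree; if they do not,
  the hyperplanes are disjoint translates of the orthogonal complement of \<open>c1\<close>. In that case
  projecting onto \<open>H2\<close> only moves a point along \<open>c1\<close>, which the projection onto \<open>H1\<close> then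
  forgets. The composition of the two is therefore the projection onto \<open>H1\<close>, and its fixed points
  are the points of \<open>H1\<close>.

  If the inequality is strict, the Gram determinant of \<open>c1\<close> and \<open>c2\<close> is nonzero, and Cramer's
  rule gives the only point \<open>x + a *\<^sub>R c1 + b *\<^sub>R c2\<close> on both hyperplanes. Its displacement from
  \<open>x\<close> is a combination of the normals, hence orthogonal to the intersection.
\<close>

text \<open>The obtuse-angle criterion holds because, expanding the square,
  \<open>(dist x y)\<^sup>2 \<ge> (dist x p)\<^sup>2 + (dist p y)\<^sup>2\<close> for every \<open>y\<close> in \<open>C\<close>; the last summand also
  forces uniqueness, which the definite description requires.\<close>

lemma nearest_point_eqI:
  assumes p: "p \<in> C" and obtuse: "\<And>y. y \<in> C \<Longrightarrow> (x - p) \<bullet> (y - p) \<le> 0"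
  shows "nearest_point C x = p"
proof -
  have pyth: "(dist x p)\<^sup>2 + (dist p y)\<^sup>2 \<le> (dist x y)\<^sup>2" if "y \<in> C" for y
  proof -
    have "(dist x y)\<^sup>2 = (dist x p)\<^sup>2 + (dist p y)\<^sup>2 - 2 * ((x - p) \<bullet> (y - p))"
      by (simp add: dist_norm power2_norm_eq_inner inner_diff_left inner_diff_right inner_commute)
    with obtuse[OF that] show ?thesis by simp
  qed
  have "dist x p \<le> dist x y" if "y \<in> C" for y
  proof (rule power2_le_imp_le)
    show "(dist x p)\<^sup>2 \<le> (dist x y)\<^sup>2"
      using pyth[OF that] zero_le_power2[of "dist p y"] by linarith
  qed simp
  moreover have "q = p" if q: "q \<in> C" "\<forall>y\<in>C. dist x q \<le> dist x y" for q
  proof -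
    have "(dist x q)\<^sup>2 \<le> (dist x p)\<^sup>2"
      using q p by (intro power_mono) auto
    then have "(dist p q)\<^sup>2 \<le> 0" using pyth[OF q(1)] by linarith
    then show "q = p" by simp
  qed
  ultimately show ?thesis
    unfolding nearest_point_def using p by (intro the_equality) blast+
qed

lemma nearest_point_hyperplane:
  assumes "c \<noteq> 0"
  shows "nearest_point {z. z \<bullet> c = \<gamma>} x = x - ((x \<bullet> c - \<gamma>) / (norm c)\<^sup>2) *\<^sub>R c"
    (is "_ = x - ?s *\<^sub>R c")
proof (rule nearest_point_eqI)
  have foot: "(x - ?s *\<^sub>R c) \<bullet> c = \<gamma>"
    using assms by (simp add: inner_diff_left power2_norm_eq_inner)
  then show "x - ?s *\<^sub>R c \<in> {z. z \<bullet> c = \<gamma>}" by simp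
  fix y assume "y \<in> {z. z \<bullet> c = \<gamma>}"
  with foot have "(y - (x - ?s *\<^sub>R c)) \<bullet> c = 0"
    by (simp only: inner_diff_left[of y] mem_Collect_eq)
  then show "(x - (x - ?s *\<^sub>R c)) \<bullet> (y - (x - ?s *\<^sub>R c)) \<le> 0"
    by (simp add: inner_commute[of c "y - _"])
qed

lemma nearest_point_hyperplane_shift:
  assumes "c \<noteq> 0"
  shows "nearest_point {z. z \<bullet> c = \<gamma>} (x + s *\<^sub>R c) = nearest_point {z. z \<bullet> c = \<gamma>} x"
  using assms
  by (simp add: nearest_point_hyperplane inner_add_left power2_norm_eq_inner
      diff_divide_distrib add_divide_distrib algebra_simps)

lemma Fix_nearest_point_hyperplane:
  assumes "c \<noteq> 0"
  shows "Fix (nearest_point {z. z \<bullet> c = \<gamma>}) = {z. z \<bullet> c = \<gamma>}"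
  using assms by (auto simp: Fix_def nearest_point_hyperplane)

text \<open>Subtracting from \<open>d\<close> its orthogonal projection onto the line through \<open>c\<close> leaves a vector
  whose squared norm is, up to the factor \<open>(norm c)\<^sup>2\<close>, the defect in the Cauchy--Schwarz
  inequality.\<close>

lemma Cauchy_Schwarz_eq_imp_scaleR:
  fixes c d :: "'a::real_inner"
  assumes "c \<noteq> 0" and eq: "(c \<bullet> d)\<^sup>2 = (norm c)\<^sup>2 * (norm d)\<^sup>2"
  shows "d = ((c \<bullet> d) / (norm c)\<^sup>2) *\<^sub>R c"
proof -
  let ?t = "(c \<bullet> d) / (norm c)\<^sup>2"
  have "(norm (d - ?t *\<^sub>R c))\<^sup>2 = (norm d)\<^sup>2 - (c \<bullet> d)\<^sup>2 / (norm c)\<^sup>2"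
    using assms(1)
    by (simp add: power2_norm_eq_inner inner_diff_left inner_diff_right inner_commute[of d c])
      (simp add: power2_eq_square)
  also have "\<dots> = 0" using assms by simp
  finally show ?thesis by simp
qed

text \<open>Any point of the hyperplane could serve as the base point; the multiple of the normal used here
  is its point closest to the origin.\<close>

lemma hyperplane_eq_translate:
  fixes c :: "'a::real_inner"
  assumes "c \<noteq> 0"
  shows "{z. z \<bullet> c = \<gamma>} = (\<lambda>v. (\<gamma> / (c \<bullet> c)) *\<^sub>R c + v) ` {v. v \<bullet> c = 0}"
proof (intro equalityI subsetI)
  fix z assume "z \<in> {z. z \<bullet> c = \<gamma>}"
  then show "z \<in> (\<lambda>v. (\<gamma> / (c \<bullet> c)) *\<^sub>R c + v) ` {v. v \<bullet> c = 0}"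
    using assms
    by (intro image_eqI[of _ _ "z - (\<gamma> / (c \<bullet> c)) *\<^sub>R c"]) (auto simp: inner_diff_left)
qed (use assms in \<open>auto simp: inner_add_left\<close>)

lemma parallel_hyperplanes:
  fixes c :: "'a::real_inner"
  assumes "c \<noteq> 0"
  shows "parallel {z. z \<bullet> c = \<gamma>} {z. z \<bullet> c = \<delta>}"
proof -
  have "subspace {v. v \<bullet> c = 0}"
    by (simp add: subspace_def inner_add_left)
  then show ?thesis
    unfolding parallel_def
    using hyperplane_eq_translate[OF assms, of \<gamma>] hyperplane_eq_translate[OF assms, of \<delta>] by blast
qed

text \<open>The projection onto the second hyperplane moves a point by a multiple of the common normal,
  which is invisible to the projection onto the first one.\<close>

lemma nearest_point_parallel_hyperplanes_comp:
  assumes "c \<noteq> 0"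
  shows "nearest_point {z. z \<bullet> c = \<gamma>} \<circ> nearest_point {z. z \<bullet> c = \<delta>} =
    nearest_point {z. z \<bullet> c = \<gamma>}"
proof
  fix z
  show "(nearest_point {z. z \<bullet> c = \<gamma>} \<circ> nearest_point {z. z \<bullet> c = \<delta>}) z =
      nearest_point {z. z \<bullet> c = \<gamma>} z"
    using nearest_point_hyperplane_shift[OF assms, of \<gamma> z "- ((z \<bullet> c - \<delta>) / (norm c)\<^sup>2)"]
    by (simp add: nearest_point_hyperplane[OF assms, of \<delta>])
qed

text \<open>A displacement in the span of both normals that lands in the intersection is orthogonal to
  the intersection.\<close>

lemma nearest_point_hyperplane_Int:
  assumes "x + a *\<^sub>R c + b *\<^sub>R d \<in> {z. z \<bullet> c = \<gamma>} \<inter> {z. z \<bullet> d = \<delta>}"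
  shows "nearest_point ({z. z \<bullet> c = \<gamma>} \<inter> {z. z \<bullet> d = \<delta>}) x = x + a *\<^sub>R c + b *\<^sub>R d"
proof (rule nearest_point_eqI[OF assms])
  let ?p = "x + a *\<^sub>R c + b *\<^sub>R d"
  fix y assume "y \<in> {z. z \<bullet> c = \<gamma>} \<inter> {z. z \<bullet> d = \<delta>}"
  then have "(y - ?p) \<bullet> c = 0" "(y - ?p) \<bullet> d = 0"
    using assms by (auto simp only: inner_diff_left Int_iff mem_Collect_eq)
  moreover have "(x - ?p) \<bullet> (y - ?p) = - (a * ((y - ?p) \<bullet> c)) - b * ((y - ?p) \<bullet> d)"
    by (simp add: inner_diff_left inner_diff_right inner_add_left inner_add_right inner_commute
        algebra_simps)
  ultimately show "(x - ?p) \<bullet> (y - ?p) \<le> 0" by simp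
qed

text \<open>Cramer's rule for the system whose matrix is the Gram matrix of \<open>c\<close> and \<open>d\<close>.\<close>

lemma Gram_solution_mem_hyperplane_Int:
  fixes c d x :: "'a::real_inner"
  assumes "(c \<bullet> d)\<^sup>2 \<noteq> (norm c)\<^sup>2 * (norm d)\<^sup>2"
  defines "D \<equiv> (norm c)\<^sup>2 * (norm d)\<^sup>2 - (c \<bullet> d)\<^sup>2"
  shows "x + (((norm d)\<^sup>2 * (\<gamma> - x \<bullet> c) + (c \<bullet> d) * (x \<bullet> d - \<delta>)) / D) *\<^sub>R c
           + (((norm c)\<^sup>2 * (\<delta> - x \<bullet> d) + (c \<bullet> d) * (x \<bullet> c - \<gamma>)) / D) *\<^sub>R d
         \<in> {z. z \<bullet> c = \<gamma>} \<inter> {z. z \<bullet> d = \<delta>}" (is "x + (?a / D) *\<^sub>R c + (?b / D) *\<^sub>R d \<in> _")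
proof -
  have D: "D \<noteq> 0" using assms by simp
  have "?a * (c \<bullet> c) + ?b * (c \<bullet> d) = (\<gamma> - x \<bullet> c) * D"
    "?a * (c \<bullet> d) + ?b * (d \<bullet> d) = (\<delta> - x \<bullet> d) * D"
    unfolding D_def power2_norm_eq_inner by algebra+
  then have "?a / D * (c \<bullet> c) + ?b / D * (c \<bullet> d) = \<gamma> - x \<bullet> c"
    "?a / D * (c \<bullet> d) + ?b / D * (d \<bullet> d) = \<delta> - x \<bullet> d"
    using D by (simp_all only: times_divide_eq_left add_divide_distrib[symmetric]) simp_all
  then show ?thesis
    by (simp only: inner_add_left inner_scaleR_left inner_commute[of d c] Int_iff mem_Collect_eq
        add.assoc) simp
qed

theorem corollary4p2:
  fixes c1 c2 x :: "'a::{real_inner,complete_space}"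
    and \<gamma>1 \<gamma>2 :: real
    and H1 H2 :: "'a set"
  assumes c1: "c1 \<noteq> 0" and c2: "c2 \<noteq> 0"
    and H1: "H1 = {z. z \<bullet> c1 = \<gamma>1}"
    and H2: "H2 = {z. z \<bullet> c2 = \<gamma>2}"
  shows
    "((c1 \<bullet> c2)\<^sup>2 = (norm c1)\<^sup>2 * (norm c2)\<^sup>2 \<and>
        (norm c1)\<^sup>2 * (x \<bullet> c2 - \<gamma>2) = (c1 \<bullet> c2) * (x \<bullet> c1 - \<gamma>1)
      \<longrightarrow> H1 = H2 \<and>
          nearest_point (H1 \<inter> H2) x = nearest_point H1 x \<and>
          nearest_point H1 x = x - ((x \<bullet> c1 - \<gamma>1) / (norm c1)\<^sup>2) *\<^sub>R c1)
   \<and> ((c1 \<bullet> c2)\<^sup>2 = (norm c1)\<^sup>2 * (norm c2)\<^sup>2 \<and>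
        (norm c1)\<^sup>2 * (x \<bullet> c2 - \<gamma>2) \<noteq> (c1 \<bullet> c2) * (x \<bullet> c1 - \<gamma>1)
      \<longrightarrow> parallel H1 H2 \<and> H1 \<noteq> H2 \<and> H1 \<inter> H2 = {} \<and>
          nearest_point (Fix (nearest_point H1 \<circ> nearest_point H2)) x = nearest_point H1 x \<and>
          nearest_point H1 x = x - ((x \<bullet> c1 - \<gamma>1) / (norm c1)\<^sup>2) *\<^sub>R c1)
   \<and> ((c1 \<bullet> c2)\<^sup>2 \<noteq> (norm c1)\<^sup>2 * (norm c2)\<^sup>2
      \<longrightarrow> H1 \<inter> H2 \<noteq> {} \<and>
          nearest_point (H1 \<inter> H2) x =
            x + (((norm c2)\<^sup>2 * (\<gamma>1 - x \<bullet> c1) + (c1 \<bullet> c2) * (x \<bullet> c2 - \<gamma>2)) /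
                 ((norm c1)\<^sup>2 * (norm c2)\<^sup>2 - (c1 \<bullet> c2)\<^sup>2)) *\<^sub>R c1
              + (((norm c1)\<^sup>2 * (\<gamma>2 - x \<bullet> c2) + (c1 \<bullet> c2) * (x \<bullet> c1 - \<gamma>1)) /
                 ((norm c1)\<^sup>2 * (norm c2)\<^sup>2 - (c1 \<bullet> c2)\<^sup>2)) *\<^sub>R c2)"
proof -
  have degenerate: "\<exists>t. t \<noteq> 0 \<and> c1 \<bullet> c2 = t * (norm c1)\<^sup>2 \<and> (\<forall>z. z \<bullet> c2 = t * (z \<bullet> c1)) \<and>
      H2 = {z. z \<bullet> c1 = \<gamma>2 / t}"
    if eq: "(c1 \<bullet> c2)\<^sup>2 = (norm c1)\<^sup>2 * (norm c2)\<^sup>2"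
  proof -
    define t where "t = (c1 \<bullet> c2) / (norm c1)\<^sup>2"
    have c2_eq: "c2 = t *\<^sub>R c1"
      using Cauchy_Schwarz_eq_imp_scaleR[OF c1 eq] by (simp add: t_def)
    with c2 have t: "t \<noteq> 0" by auto
    moreover have "c1 \<bullet> c2 = t * (norm c1)\<^sup>2" using c1 by (simp add: t_def)
    moreover have level: "z \<bullet> c2 = t * (z \<bullet> c1)" for z by (simp add: c2_eq)
    moreover have "H2 = {z. z \<bullet> c1 = \<gamma>2 / t}"
      unfolding H2 level using t by (auto simp: field_simps)
    ultimately show ?thesis by blast
  qed
  \<comment> \<open>Once the normals are proportional, the distinction between (i) and (ii) is whether the two
    levels of \<open>\<lambda>z. z \<bullet> c1\<close> agree, whatever the point \<open>x\<close> is.\<close>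
  have levels: "(norm c1)\<^sup>2 * (x \<bullet> c2 - \<gamma>2) = (c1 \<bullet> c2) * (x \<bullet> c1 - \<gamma>1) \<longleftrightarrow> \<gamma>2 / t = \<gamma>1"
    if "t \<noteq> 0" "c1 \<bullet> c2 = t * (norm c1)\<^sup>2" "x \<bullet> c2 = t * (x \<bullet> c1)" for t
  proof -
    have "(norm c1)\<^sup>2 * (x \<bullet> c2 - \<gamma>2) = (c1 \<bullet> c2) * (x \<bullet> c1 - \<gamma>1) \<longleftrightarrow>
        (norm c1)\<^sup>2 * (t * (x \<bullet> c1) - \<gamma>2) = (norm c1)\<^sup>2 * (t * (x \<bullet> c1) - t * \<gamma>1)"
      unfolding that(2,3) by (simp add: algebra_simps)
    also have "\<dots> \<longleftrightarrow> \<gamma>2 / t = \<gamma>1" using c1 that(1) by (auto simp: field_simps)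
    finally show ?thesis .
  qed
  show ?thesis
  proof (intro conjI[of "_ \<longrightarrow> _"] impI)
    assume A: "(c1 \<bullet> c2)\<^sup>2 = (norm c1)\<^sup>2 * (norm c2)\<^sup>2 \<and>
        (norm c1)\<^sup>2 * (x \<bullet> c2 - \<gamma>2) = (c1 \<bullet> c2) * (x \<bullet> c1 - \<gamma>1)"
    obtain t where "t \<noteq> 0" "c1 \<bullet> c2 = t * (norm c1)\<^sup>2" "x \<bullet> c2 = t * (x \<bullet> c1)"
      and H2': "H2 = {z. z \<bullet> c1 = \<gamma>2 / t}"
      using degenerate A by blast
    then have "\<gamma>2 / t = \<gamma>1" using levels A by blast
    then have "H1 = H2" unfolding H1 H2' by simp
    moreover have "nearest_point H1 x = x - ((x \<bullet> c1 - \<gamma>1) / (norm c1)\<^sup>2) *\<^sub>R c1"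
      unfolding H1 by (rule nearest_point_hyperplane[OF c1])
    ultimately show "H1 = H2 \<and> nearest_point (H1 \<inter> H2) x = nearest_point H1 x \<and>
        nearest_point H1 x = x - ((x \<bullet> c1 - \<gamma>1) / (norm c1)\<^sup>2) *\<^sub>R c1"
      by simp
  next
    assume A: "(c1 \<bullet> c2)\<^sup>2 = (norm c1)\<^sup>2 * (norm c2)\<^sup>2 \<and>
        (norm c1)\<^sup>2 * (x \<bullet> c2 - \<gamma>2) \<noteq> (c1 \<bullet> c2) * (x \<bullet> c1 - \<gamma>1)"
    obtain t where "t \<noteq> 0" "c1 \<bullet> c2 = t * (norm c1)\<^sup>2" "x \<bullet> c2 = t * (x \<bullet> c1)"
      and H2': "H2 = {z. z \<bullet> c1 = \<gamma>2 / t}"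
      using degenerate A by blast
    then have "\<gamma>2 / t \<noteq> \<gamma>1" using levels A by blast
    then have disj: "H1 \<inter> H2 = {}" unfolding H1 H2' by auto
    have foot: "nearest_point H1 x = x - ((x \<bullet> c1 - \<gamma>1) / (norm c1)\<^sup>2) *\<^sub>R c1"
      unfolding H1 by (rule nearest_point_hyperplane[OF c1])
    have "(\<gamma>1 / (c1 \<bullet> c1)) *\<^sub>R c1 \<in> H1" unfolding H1 using c1 by simp
    with disj have "H1 \<noteq> H2" by blast
    moreover have "parallel H1 H2" unfolding H1 H2' by (rule parallel_hyperplanes[OF c1])
    moreover have "Fix (nearest_point H1 \<circ> nearest_point H2) = H1"
      unfolding H1 H2' nearest_point_parallel_hyperplanes_comp[OF c1]
      by (rule Fix_nearest_point_hyperplane[OF c1])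
    ultimately show "parallel H1 H2 \<and> H1 \<noteq> H2 \<and> H1 \<inter> H2 = {} \<and>
        nearest_point (Fix (nearest_point H1 \<circ> nearest_point H2)) x = nearest_point H1 x \<and>
        nearest_point H1 x = x - ((x \<bullet> c1 - \<gamma>1) / (norm c1)\<^sup>2) *\<^sub>R c1"
      using disj foot by simp
  next
    assume "(c1 \<bullet> c2)\<^sup>2 \<noteq> (norm c1)\<^sup>2 * (norm c2)\<^sup>2"
    note mem = Gram_solution_mem_hyperplane_Int[OF this, of x \<gamma>1 \<gamma>2, folded H1 H2]
    have "nearest_point (H1 \<inter> H2) x =
        x + (((norm c2)\<^sup>2 * (\<gamma>1 - x \<bullet> c1) + (c1 \<bullet> c2) * (x \<bullet> c2 - \<gamma>2)) /
             ((norm c1)\<^sup>2 * (norm c2)\<^sup>2 - (c1 \<bullet> c2)\<^sup>2)) *\<^sub>R c1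
          + (((norm c1)\<^sup>2 * (\<gamma>2 - x \<bullet> c2) + (c1 \<bullet> c2) * (x \<bullet> c1 - \<gamma>1)) /
             ((norm c1)\<^sup>2 * (norm c2)\<^sup>2 - (c1 \<bullet> c2)\<^sup>2)) *\<^sub>R c2" (is "_ = ?p")
      using mem unfolding H1 H2 by (rule nearest_point_hyperplane_Int)
    with mem show "H1 \<inter> H2 \<noteq> {} \<and> nearest_point (H1 \<inter> H2) x = ?p"
      by blast
  qed
qed

end
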